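(* For every prime $p>2$, \[ \sum_{n=0}^{p-1}\frac{(-1)^n(20n^2+8n+1)}{2^{12n}}\binom{2n}{n}^5\equiv 0\pmod{p^2} \] and \[ \sum_{n=0}^{p-1}\frac{(-1)^n(820n^2+180n+13)}{2^{20n}}\binom{2n}{n}^5\equiv 0\pmod{p}. \]
   Context: For rational numbers $x,y$ and a prime $p$, $x\equiv y\pmod{p^r}$ means that $x-y$ is a rational number whose $p$-adic valuation is at least $r$. *)

theory Defs
  imports Complex_Main "HOL-Computational_Algebra.Primes"
begin

(* The value at 0 is a junk value, because multiplicity p 0 = 0; the p-adic valuation
   of 0 is infinite, which rat_cong takes into account. *)
definition padic_val :: "nat \<Rightarrow> rat \<Rightarrow> int" where
  "padic_val p x =
     int (multiplicity (int p) (fst (quotient_of x)))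
     - int (multiplicity (int p) (snd (quotient_of x)))"

(* rat_cong p r x y means x = y modulo p^r. The numbers x and y need not be p-integral. *)
definition rat_cong :: "nat \<Rightarrow> nat \<Rightarrow> rat \<Rightarrow> rat \<Rightarrow> bool" where
  "rat_cong p r x y \<longleftrightarrow> x - y = 0 \<or> padic_val p (x - y) \<ge> int r"

end

theory Submission
  imports Defs
begin

text \<open>
  The proof replaces the congruences by exact identities. Write \<open>p = 2 m + 1\<close> and consider
  the well-poised sums
  \<open>\<omega>(a; b, c, d, e) = \<Sum>\<^sub>j (a + 2 j) (b)\<^sub>j (c)\<^sub>j (d)\<^sub>j (e)\<^sub>j / ((1+a-b)\<^sub>j (1+a-c)\<^sub>j (1+a-d)\<^sub>j (1+a-e)\<^sub>j)\<close>.
  Abel summation by parts relates \<open>(1 + 2 a - b - c - d - e) \<omega>(a; b, c, d, e)\<close> to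
  \<open>\<omega>(a+2; b+1, c+1, d+1, e)\<close> and to \<open>\<omega>(a+3; b+1, c+1, d+1, e+1)\<close>. At
  \<open>(1/2; (1+p)/2, (1-p)/2, 1/2, 1/2)\<close> the left-hand factor is 0 and the sum terminates since
  \<open>(1-p)/2 = -m\<close>, so iterating either relation \<open>m\<close> times writes 0 as a finite sum. With \<open>p\<close>
  replaced by 0 in the parameters, its terms become those of the two series; \<open>p\<close> enters only
  through \<open>p\<^sup>2\<close> because of the symmetry between \<open>b\<close> and \<open>c\<close>, and no denominator of a term with
  \<open>n < m\<close> is divisible by \<open>p\<close>; the last \<open>\<omega>\<close>, where \<open>c = 0\<close>, is just \<open>a\<close>.
  Hence both sums up to \<open>m\<close> vanish modulo \<open>p\<^sup>2\<close>, and the terms with \<open>m < n < p\<close> are divisible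
  by \<open>p\<^sup>5\<close>.
\<close>

subsection \<open>Contiguous relations of well-poised sums\<close>

text \<open>For generic \<open>a\<close> this is \<open>a\<close> times the summand of the
  very-well-poised 7F6 series at 1 with numerator parameters a, 1 + a/2, b, c, d, e, 1; the
  parameter 1 cancels the factor (a)_j / j!.\<close>

definition well_poised_term :: "'a::field_char_0 \<Rightarrow> 'a \<Rightarrow> 'a \<Rightarrow> 'a \<Rightarrow> 'a \<Rightarrow> nat \<Rightarrow> 'a" where
  "well_poised_term a b c d e j = (a + 2 * of_nat j) *
     (pochhammer b j * pochhammer c j * pochhammer d j * pochhammer e j) /
     (pochhammer (1 + a - b) j * pochhammer (1 + a - c) j *
      pochhammer (1 + a - d) j * pochhammer (1 + a - e) j)"

text \<open>The hypothesis \<open>pochhammer c N = 0\<close> of the relations below makes all terms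
  from index \<open>N\<close> on vanish, so this finite sum is the whole series.\<close>

definition well_poised_sum :: "nat \<Rightarrow> 'a::field_char_0 \<Rightarrow> 'a \<Rightarrow> 'a \<Rightarrow> 'a \<Rightarrow> 'a \<Rightarrow> 'a" where
  "well_poised_sum N a b c d e = (\<Sum>j<N. well_poised_term a b c d e j)"

lemma pochhammer_nonzero:
  fixes x :: "'a::field_char_0"
  assumes "\<And>i. x + of_nat i \<noteq> 0"
  shows "pochhammer x j \<noteq> 0"
  using assms by (auto simp: pochhammer_eq_0_iff add_eq_0_iff2)

lemma pochhammer_shift:
  fixes x :: "'a::field_char_0"
  shows "x * pochhammer (x + 1) j = pochhammer x j * (x + of_nat j)"
  by (metis pochhammer_rec pochhammer_Suc)

text \<open>The term at index 0 is \<open>a\<close>. The rest is well poised again, since 1 + a - x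
  grows by 1 when a grows by 2 and x by 1.\<close>

lemma well_poised_sum_index_shift:
  fixes a b c d e :: "'a::field_char_0"
  assumes "pochhammer c N = 0"
  shows "well_poised_sum N a b c d e =
    a + b * c * d * e / ((1 + a - b) * (1 + a - c) * (1 + a - d) * (1 + a - e)) *
      well_poised_sum N (a + 2) (b + 1) (c + 1) (d + 1) (e + 1)"
proof -
  have *: "well_poised_term a b c d e (Suc j) =
    b * c * d * e / ((1 + a - b) * (1 + a - c) * (1 + a - d) * (1 + a - e)) *
      well_poised_term (a + 2) (b + 1) (c + 1) (d + 1) (e + 1) j" for j
  proof -
    have "1 + (a + 2) - (x + 1) = 1 + a - x + 1" for x by simp
    moreover have "a + 2 * of_nat (Suc j) = a + 2 + 2 * of_nat j" by simp
    ultimately show ?thesis unfolding well_poised_term_def pochhammer_rec by (simp add: mult_ac add_ac)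
  qed
  \<comment> \<open>A further term, zero by \<open>assms\<close>, is appended so that removing index
    0 leaves exactly \<open>N\<close> terms.\<close>
  have "well_poised_sum N a b c d e = (\<Sum>j<Suc N. well_poised_term a b c d e j)"
    using assms by (simp add: well_poised_sum_def well_poised_term_def)
  also have "\<dots> = a + (\<Sum>j<N. well_poised_term a b c d e (Suc j))"
    by (subst sum.lessThan_Suc_shift) (simp add: well_poised_term_def)
  finally show ?thesis by (simp add: well_poised_sum_def sum_distrib_left *)
qed

text \<open>
  The polynomial factor of \<open>u (j + 1) - u j\<close> in the proof is odd under \<open>j \<mapsto> -a - j\<close>, hence a
  multiple of \<open>a + 2 j\<close>; this makes the difference a combination of two well-poised terms.
\<close>

lemma well_poised_sum_raise_e:
  fixes a b c d e :: "'a::field_char_0"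
  assumes c: "pochhammer c N = 0"
    and nz: "\<And>i. 1 + a - b + of_nat i \<noteq> 0" "\<And>i. 1 + a - c + of_nat i \<noteq> 0"
      "\<And>i. 1 + a - d + of_nat i \<noteq> 0" "\<And>i. a - e + of_nat i \<noteq> 0"
  shows "(a - e) * e * (b + c + d + e - 2 * a) * well_poised_sum N a b c d (e + 1) =
    (a - b - e) * (a - c - e) * (a - d - e) * well_poised_sum N a b c d e
      - (a - b) * (a - c) * (a - d) * (a - e)"
proof -
  define K where "K j = pochhammer b j * pochhammer c j * pochhammer d j * pochhammer e j /
     (pochhammer (1 + a - b) j * pochhammer (1 + a - c) j *
      pochhammer (1 + a - d) j * pochhammer (1 + a - e) j)" for j
  define u where "u j = K j * ((a - b + of_nat j) * (a - c + of_nat j) *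
      (a - d + of_nat j) * (a - e + of_nat j))" for j
  have nze: "1 + a - e + of_nat i \<noteq> 0" for i
    using nz(4)[of "Suc i"] by (simp add: algebra_simps)
  note ph = pochhammer_nonzero[OF nz(1)] pochhammer_nonzero[OF nz(2)]
    pochhammer_nonzero[OF nz(3)] pochhammer_nonzero[OF nz(4)] pochhammer_nonzero[OF nze]
  have u_Suc: "u (Suc j) = K j * ((b + of_nat j) * (c + of_nat j) * (d + of_nat j) * (e + of_nat j))" for j
    using nz(1)[of j] nz(2)[of j] nz(3)[of j] nze[of j]
    by (simp add: u_def K_def pochhammer_Suc add.commute add.left_commute add_diff_eq mult_ac)
  have term_e: "well_poised_term a b c d e j = (a + 2 * of_nat j) * K j" for j
    by (simp add: well_poised_term_def K_def)
  \<comment> \<open>Raising e by 1 multiplies the term by (e + j)(a - e + j) / (e (a - e)); the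
    prefactor clears this denominator.\<close>
  have term_e1: "(a - e) * e * well_poised_term a b c d (e + 1) j =
      (a + 2 * of_nat j) * K j * ((e + of_nat j) * (a - e + of_nat j))" for j
  proof -
    have 1: "e * pochhammer (e + 1) j = pochhammer e j * (e + of_nat j)"
      by (rule pochhammer_shift)
    have "(a - e) * pochhammer (1 + a - e) j = pochhammer (a - e) j * (a - e + of_nat j)"
      using pochhammer_shift[of "a - e" j] by (simp add: algebra_simps)
    then have 2: "(a - e) / pochhammer (a - e) j = (a - e + of_nat j) / pochhammer (1 + a - e) j"
      using ph by (simp add: field_simps)
    have "(a - e) * e * well_poised_term a b c d (e + 1) j = (a + 2 * of_nat j) *
       (pochhammer b j * pochhammer c j * pochhammer d j * (e * pochhammer (e + 1) j)) /
       (pochhammer (1 + a - b) j * pochhammer (1 + a - c) j * pochhammer (1 + a - d) j)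
       * ((a - e) / pochhammer (a - e) j)"
      by (simp add: well_poised_term_def)
    then show ?thesis unfolding 1 2 by (simp add: K_def)
  qed
  have "u (Suc j) - u j = (b + c + d + e - 2 * a) * ((a - e) * e * well_poised_term a b c d (e + 1) j)
      - (a - b - e) * (a - c - e) * (a - d - e) * well_poised_term a b c d e j" for j
    unfolding u_Suc term_e term_e1 unfolding u_def by algebra
  then have "(\<Sum>j<N. u (Suc j) - u j) =
      (b + c + d + e - 2 * a) * ((a - e) * e * well_poised_sum N a b c d (e + 1))
      - (a - b - e) * (a - c - e) * (a - d - e) * well_poised_sum N a b c d e"
    by (simp add: well_poised_sum_def sum_distrib_left sum_subtractf)
  \<comment> \<open>\<open>u N\<close> is 0 because \<open>K N\<close> contains
    \<open>pochhammer c N\<close>, and \<open>K 0\<close> is 1, so only \<open>- u 0\<close>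
    survives.\<close>
  moreover have "(\<Sum>j<N. u (Suc j) - u j) = - ((a - b) * (a - c) * (a - d) * (a - e))"
    using c by (simp add: sum_lessThan_telescope) (simp add: u_def K_def)
  ultimately show ?thesis by (simp add: algebra_simps)
qed

text \<open>Abel summation again, now with an extra linear factor in \<open>u\<close>: the
  difference becomes a combination of the terms at (a, e) and at (a + 1, e + 1).\<close>

lemma well_poised_sum_raise_a_e:
  fixes a b c d e :: "'a::field_char_0"
  assumes c: "pochhammer c N = 0"
    and nz: "\<And>i. 1 + a - b + of_nat i \<noteq> 0" "\<And>i. 1 + a - c + of_nat i \<noteq> 0"
      "\<And>i. 1 + a - d + of_nat i \<noteq> 0" "\<And>i. 1 + a - e + of_nat i \<noteq> 0"
  shows "(1 + 2 * a - b - c - d - e) * well_poised_sum N a b c d e =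
    (a - e) * (1 + 2 * a - b - c - d) +
    e * (1 + a - b - c) * (1 + a - b - d) * (1 + a - c - d) /
      ((1 + a - b) * (1 + a - c) * (1 + a - d)) * well_poised_sum N (a + 1) b c d (e + 1)"
proof -
  \<comment> \<open>With \<open>Suc j\<close> in three denominators \<open>K j\<close> is a factor
    common to both terms: passing to (a + 1, e + 1) shifts 1 + a - b, 1 + a - c and 1 + a - d but
    leaves 1 + a - e fixed.\<close>
  define K where "K j = pochhammer b j * pochhammer c j * pochhammer d j * pochhammer e j /
     (pochhammer (1 + a - b) (Suc j) * pochhammer (1 + a - c) (Suc j) *
      pochhammer (1 + a - d) (Suc j) * pochhammer (1 + a - e) j)" for j
  define u where "u j = K j * ((1 + a - b + of_nat j) * (1 + a - c + of_nat j) *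
      (1 + a - d + of_nat j) * (a - e + of_nat j)) * (of_nat j + 1 + 2 * a - b - c - d)" for j
  define r where "r = e * (1 + a - b - c) * (1 + a - b - d) * (1 + a - c - d) /
      ((1 + a - b) * (1 + a - c) * (1 + a - d))"
  have u_Suc: "u (Suc j) = K j * ((b + of_nat j) * (c + of_nat j) * (d + of_nat j) * (e + of_nat j))
      * (of_nat j + 2 + 2 * a - b - c - d)" for j
    using nz(1)[of "Suc j"] nz(2)[of "Suc j"] nz(3)[of "Suc j"] nz(4)[of j]
    by (simp add: u_def K_def pochhammer_Suc add.commute add.left_commute add_diff_eq mult_ac)
  have term_a: "well_poised_term a b c d e j = (a + 2 * of_nat j) * K j *
      ((1 + a - b + of_nat j) * (1 + a - c + of_nat j) * (1 + a - d + of_nat j))" for j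
    using nz(1)[of j] nz(2)[of j] nz(3)[of j] by (simp add: well_poised_term_def K_def pochhammer_Suc mult_ac)
  have term_a1: "r * well_poised_term (a + 1) b c d (e + 1) j =
      (a + 1 + 2 * of_nat j) * K j * (e + of_nat j) *
      ((1 + a - b - c) * (1 + a - b - d) * (1 + a - c - d))" for j
  proof -
    have "r * well_poised_term (a + 1) b c d (e + 1) j = (a + 1 + 2 * of_nat j) *
       (pochhammer b j * pochhammer c j * pochhammer d j * (e * pochhammer (e + 1) j)) /
       (((1 + a - b) * pochhammer (1 + a - b + 1) j) * ((1 + a - c) * pochhammer (1 + a - c + 1) j)
         * ((1 + a - d) * pochhammer (1 + a - d + 1) j) * pochhammer (1 + a - e) j) *
       ((1 + a - b - c) * (1 + a - b - d) * (1 + a - c - d))"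
    proof -
      have eqs: "1 + (a + 1) - b = 1 + a - b + 1" "1 + (a + 1) - c = 1 + a - c + 1"
        "1 + (a + 1) - d = 1 + a - d + 1" "1 + (a + 1) - (e + 1) = 1 + a - e"
        by simp_all
      show ?thesis unfolding well_poised_term_def r_def eqs by (simp add: mult_ac)
    qed
    then show ?thesis unfolding pochhammer_rec[symmetric]
      unfolding pochhammer_rec[of e] K_def pochhammer_shift by simp
  qed
  have "u (Suc j) - u j = r * well_poised_term (a + 1) b c d (e + 1) j
      - (1 + 2 * a - b - c - d - e) * well_poised_term a b c d e j" for j
    unfolding u_Suc term_a term_a1 unfolding u_def by algebra
  then have "(\<Sum>j<N. u (Suc j) - u j) =
      r * well_poised_sum N (a + 1) b c d (e + 1) - (1 + 2 * a - b - c - d - e) * well_poised_sum N a b c d e"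
    by (simp add: well_poised_sum_def sum_distrib_left sum_subtractf)
  moreover have "(\<Sum>j<N. u (Suc j) - u j) = - ((a - e) * (1 + 2 * a - b - c - d))"
    using c nz[of 0] by (simp add: sum_lessThan_telescope) (simp add: u_def K_def)
  ultimately show ?thesis by (simp add: r_def algebra_simps)
qed

text \<open>Eliminating the sum at \<open>e\<close> leaves a step that keeps the last parameter e +
  1, raises a by 2 and raises b, c, d by 1.\<close>

lemma well_poised_sum_raise_a:
  fixes a b c d e :: "'a::field_char_0"
  assumes c: "pochhammer c N = 0"
    and nz: "\<And>i. 1 + a - b + of_nat i \<noteq> 0" "\<And>i. 1 + a - c + of_nat i \<noteq> 0"
      "\<And>i. 1 + a - d + of_nat i \<noteq> 0" "\<And>i. a - e + of_nat i \<noteq> 0"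
  shows "(a - e) * e * (b + c + d + e - 2 * a) * well_poised_sum N a b c d (e + 1) =
    (a - b - e) * (a - c - e) * (a - d - e) *
      (a + b * c * d * e / ((1 + a - b) * (1 + a - c) * (1 + a - d) * (1 + a - e)) *
      well_poised_sum N (a + 2) (b + 1) (c + 1) (d + 1) (e + 1))
      - (a - b) * (a - c) * (a - d) * (a - e)"
  using well_poised_sum_raise_e[OF assms] well_poised_sum_index_shift[OF c, of a b d e] by simp

lemma well_poised_sum_zero_parameter:
  fixes a b d e :: "'a::field_char_0"
  assumes "N > 0"
  shows "well_poised_sum N a b 0 d e = a"
proof -
  have "well_poised_term a b 0 d e j = (if j = 0 then a else 0)" for j
    by (simp add: well_poised_term_def pochhammer_0_left)
  then show ?thesis using assms by (simp add: well_poised_sum_def)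
qed

subsection \<open>Congruences between rational numbers\<close>

text \<open>For prime \<open>p\<close> this is the localisation of the integers at \<open>p\<close>.
  The fraction need not be reduced, so sums and products require no cancellation.\<close>

definition p_integral :: "nat \<Rightarrow> rat \<Rightarrow> bool" where
  "p_integral p x \<longleftrightarrow> (\<exists>a b. \<not> int p dvd b \<and> x = of_int a / of_int b)"

lemma p_integralI: "\<not> int p dvd b \<Longrightarrow> x = of_int a / of_int b \<Longrightarrow> p_integral p x"
  unfolding p_integral_def by blast

lemma p_integral_of_int: "prime p \<Longrightarrow> p_integral p (of_int a)"
  by (rule p_integralI[of _ 1 _ a]) (auto dest: prime_gt_1_nat)

lemma p_integral_add:
  assumes "prime p" "p_integral p x" "p_integral p y"
  shows "p_integral p (x + y)"
proof -
  obtain a b c d where "\<not> int p dvd b" "x = of_int a / of_int b"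
    "\<not> int p dvd d" "y = of_int c / of_int d"
    using assms unfolding p_integral_def by blast
  moreover from this have "b \<noteq> 0" "d \<noteq> 0" by auto
  ultimately show ?thesis using assms(1)
    by (intro p_integralI[of p "b * d" _ "a * d + c * b"])
      (auto simp: prime_dvd_mult_iff add_frac_eq)
qed

lemma p_integral_mult:
  assumes "prime p" "p_integral p x" "p_integral p y"
  shows "p_integral p (x * y)"
proof -
  obtain a b c d where "\<not> int p dvd b" "x = of_int a / of_int b"
    "\<not> int p dvd d" "y = of_int c / of_int d"
    using assms unfolding p_integral_def by blast
  then show ?thesis using assms(1)
    by (intro p_integralI[of p "b * d" _ "a * c"]) (auto simp: prime_dvd_mult_iff)
qed

text \<open>The explicit witness avoids the valuations and the special case of 0 in
  \<open>rat_cong\<close>; \<open>p_cong_imp_rat_cong\<close> returns to them at the end.\<close>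

definition p_cong :: "nat \<Rightarrow> nat \<Rightarrow> rat \<Rightarrow> rat \<Rightarrow> bool" where
  "p_cong p r x y \<longleftrightarrow> (\<exists>z. p_integral p z \<and> x = y + of_nat p ^ r * z)"

lemma p_congI: "p_integral p z \<Longrightarrow> x = y + of_nat p ^ r * z \<Longrightarrow> p_cong p r x y"
  unfolding p_cong_def by blast

lemma p_cong_refl: "prime p \<Longrightarrow> p_cong p r x x"
  by (rule p_congI[of _ 0]) (auto intro: p_integral_of_int[of p 0, simplified])

lemma p_cong_trans:
  assumes "prime p" "p_cong p r x y" "p_cong p r y z"
  shows "p_cong p r x z"
proof -
  obtain v w where vw: "p_integral p v" "x = y + of_nat p ^ r * v"
      "p_integral p w" "y = z + of_nat p ^ r * w"
    using assms unfolding p_cong_def by blast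
  show ?thesis
    by (rule p_congI[OF p_integral_add[OF assms(1) vw(1,3)]])
      (simp add: vw(2,4) algebra_simps)
qed

lemma p_cong_sym:
  assumes "prime p" "p_cong p r x y"
  shows "p_cong p r y x"
proof -
  obtain v where v: "p_integral p v" "x = y + of_nat p ^ r * v"
    using assms unfolding p_cong_def by blast
  show ?thesis
    by (rule p_congI[OF p_integral_mult[OF assms(1) p_integral_of_int[OF assms(1), of "-1"] v(1)]])
      (simp add: v(2))
qed

lemma p_cong_add:
  assumes "prime p" "p_cong p r x x'" "p_cong p r y y'"
  shows "p_cong p r (x + y) (x' + y')"
proof -
  obtain v w where vw: "p_integral p v" "x = x' + of_nat p ^ r * v"
      "p_integral p w" "y = y' + of_nat p ^ r * w"
    using assms unfolding p_cong_def by blast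
  show ?thesis
    by (rule p_congI[OF p_integral_add[OF assms(1) vw(1,3)]])
      (simp add: vw(2,4) algebra_simps)
qed

lemma p_cong_mult_left:
  assumes "prime p" "p_integral p x" "p_cong p r y y'"
  shows "p_cong p r (x * y) (x * y')"
proof -
  obtain w where w: "p_integral p w" "y = y' + of_nat p ^ r * w"
    using assms unfolding p_cong_def by blast
  show ?thesis
    by (rule p_congI[OF p_integral_mult[OF assms(1,2) w(1)]]) (simp add: w(2) algebra_simps)
qed

lemma p_cong_integral:
  assumes "prime p" "p_cong p r x y" "p_integral p y"
  shows "p_integral p x"
proof -
  obtain z where z: "p_integral p z" "x = y + of_int (int p ^ r) * z"
    using assms unfolding p_cong_def by auto
  then show ?thesis
    using assms by (metis p_integral_add p_integral_mult p_integral_of_int)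
qed

lemma p_cong_sum_0:
  assumes "prime p" "\<And>i. i \<in> A \<Longrightarrow> p_cong p r (f i) 0"
  shows "p_cong p r (sum f A) 0"
  using assms(2)
proof (induction A rule: infinite_finite_induct)
  case (insert i A)
  then show ?case
    using p_cong_add[OF assms(1), of r "f i" 0 "sum f A" 0] by simp
qed (simp_all add: p_cong_refl assms(1))

lemma p_cong_imp_rat_cong:
  assumes "prime p" "p_cong p r x y"
  shows "rat_cong p r x y"
proof (cases "x - y = 0")
  case False
  obtain a b where ab: "\<not> int p dvd b" "x - y = of_nat p ^ r * (of_int a / of_int b)"
    proof -
    obtain z where "p_integral p z" "x = y + of_nat p ^ r * z"
      using assms(2) unfolding p_cong_def by blast
    then obtain a b where "\<not> int p dvd b" "z = of_int a / of_int b" "x = y + of_nat p ^ r * z"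
      unfolding p_integral_def by blast
    then show ?thesis by (intro that[of b a]) simp_all
  qed
  obtain u v where uv: "quotient_of (x - y) = (u, v)" by fastforce
  have v: "v > 0" using quotient_of_denom_pos[OF uv] .
  have xy: "x - y = of_int u / of_int v" using quotient_of_div[OF uv] .
  have b: "b \<noteq> 0" using ab(1) by auto
  have u0: "u \<noteq> 0" using False xy by auto
  have a0: "a \<noteq> 0" using False ab(2) by auto
  have "of_int (u * b) = (of_int (int p ^ r * a * v) :: rat)"
    using xy ab(2) v b by (simp add: field_simps)
  \<comment> \<open>The multiplicities of \<open>p\<close> on both sides are compared next;
    \<open>b\<close> contributes nothing, which leaves a surplus of at least \<open>r\<close> in
    \<open>u\<close> over \<open>v\<close>.\<close>
  then have eq: "u * b = int p ^ r * a * v" by (simp only: of_int_eq_iff)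
  have pp: "prime_elem (int p)" using assms(1) by simp
  have p0: "int p \<noteq> 0" using assms(1) by (simp add: prime_gt_0_nat)
  have nu: "\<not> is_unit (int p)" using assms(1) by (auto dest: prime_gt_1_nat)
  have "multiplicity (int p) (u * b) = multiplicity (int p) u"
    using ab(1) u0 b pp by (simp add: prime_elem_multiplicity_mult_distrib not_dvd_imp_multiplicity_0)
  moreover have "multiplicity (int p) (int p ^ r * a * v) =
      r + multiplicity (int p) a + multiplicity (int p) v"
    using a0 v p0 pp nu by (simp add: prime_elem_multiplicity_mult_distrib)
  ultimately have "padic_val p (x - y) \<ge> int r"
    by (simp add: padic_val_def uv eq)
  then show ?thesis by (simp add: rat_cong_def)
qed (simp add: rat_cong_def)

text \<open>Unrolling the recurrence from 0 to \<open>m\<close> expresses \<open>W 0\<close> through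
  products of the \<open>x n\<close>; modulo p^r, \<open>U\<close> and \<open>x\<close> may be
  replaced by \<open>u\<close> and \<open>y\<close>, and \<open>s\<close> collects the products of
  the \<open>y n\<close>.\<close>

lemma backward_recurrence_sum_cong:
  assumes p: "prime p"
    and W: "\<And>n. n < m \<Longrightarrow> W n = U n + x n * W (Suc n)"
    and Wm: "p_cong p r (W m) (u m)"
    and U: "\<And>n. n < m \<Longrightarrow> p_cong p r (U n) (u n)"
    and x: "\<And>n. n < m \<Longrightarrow> p_cong p r (x n) (y n)"
    and u: "\<And>n. n \<le> m \<Longrightarrow> p_integral p (u n)"
    and y: "\<And>n. n < m \<Longrightarrow> p_integral p (y n)"
    and s: "s 0 = 1" "\<And>n. n < m \<Longrightarrow> s (Suc n) = s n * y n"
  shows "p_cong p r (\<Sum>n\<le>m. s n * u n) (W 0)"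
proof -
  have W_cong: "p_cong p r (W n) (u n + y n * W (Suc n))" if "n < m" "p_integral p (W (Suc n))" for n
    using p_cong_add[OF p U[OF that(1)] p_cong_mult_left[OF p that(2) x[OF that(1)]]]
    by (simp add: W[OF that(1)] mult.commute)
  \<comment> \<open>Replacing \<open>x n\<close> by \<open>y n\<close> needs
    \<open>W (Suc n)\<close> to be p-integral; this is carried down from \<open>m\<close> by the
    recurrence itself.\<close>
  have Wint: "p_integral p (W n)" if "n \<le> m" for n
    using that
  proof (induction rule: inc_induct)
    case base
    then show ?case using p_cong_integral[OF p Wm] u by simp
  next
    case (step n)
    then show ?case
      using p_cong_integral[OF p W_cong[OF step.hyps(2) step.IH]] p u[of n] y[of n]
      by (simp add: p_integral_add p_integral_mult)
  qed
  have sint: "p_integral p (s n)" if "n \<le> m" for n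
    using that
  proof (induction n)
    case 0
    then show ?case using p_integral_of_int[OF p, of 1] by (simp add: s(1))
  next
    case (Suc n)
    then show ?case by (simp add: s(2) p_integral_mult[OF p] y)
  qed
  \<comment> \<open>The remainder \<open>s k * W k\<close> is kept until \<open>k = m\<close>, where
    \<open>Wm\<close> turns it into the last summand.\<close>
  have "p_cong p r (W 0) ((\<Sum>n<k. s n * u n) + s k * W k)" if "k \<le> m" for k
    using that
  proof (induction k)
    case 0
    then show ?case by (simp add: s(1) p_cong_refl p)
  next
    case (Suc k)
    then have k: "k < m" by simp
    have "p_cong p r ((\<Sum>n<k. s n * u n) + s k * W k)
        ((\<Sum>n<k. s n * u n) + s k * (u k + y k * W (Suc k)))"
      using Suc.prems k by (intro p_cong_add p_cong_mult_left p p_cong_refl sint W_cong Wint) auto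
    also have "(\<Sum>n<k. s n * u n) + s k * (u k + y k * W (Suc k)) =
        (\<Sum>n<Suc k. s n * u n) + s (Suc k) * W (Suc k)"
      using k by (simp add: s(2) algebra_simps)
    finally show ?case using p_cong_trans[OF p Suc.IH] k by simp
  qed
  from this[of m] have 1: "p_cong p r (W 0) ((\<Sum>n<m. s n * u n) + s m * W m)" by simp
  have "p_cong p r ((\<Sum>n<m. s n * u n) + s m * W m) ((\<Sum>n<m. s n * u n) + s m * u m)"
    by (intro p_cong_add p_cong_mult_left p p_cong_refl sint Wm) auto
  from p_cong_sym[OF p p_cong_trans[OF p 1 this]] show ?thesis
    by (simp add: lessThan_Suc_atMost[symmetric])
qed

section \<open>Summands of the two series modulo an odd prime\<close>

definition alt_binom5 :: "nat \<Rightarrow> nat \<Rightarrow> rat" where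
  "alt_binom5 c n = (-1) ^ n / 2 ^ (c * n) * of_nat ((2 * n) choose n) ^ 5"

lemma central_binomial_Suc:
  "Suc n * ((2 * Suc n) choose Suc n) = 2 * (2 * n + 1) * ((2 * n) choose n)"
proof -
  have "Suc n * (Suc n * ((2 * Suc n) choose Suc n)) =
      Suc n * (2 * Suc n * (Suc (2 * n) choose n))"
    using Suc_times_binomial[of n "Suc (2 * n)"] by (simp del: binomial_Suc_Suc)
  also have "Suc (2 * n) choose n = Suc (2 * n) choose Suc n"
    using binomial_symmetric[of n "Suc (2 * n)"] by (simp del: binomial_Suc_Suc)
  also have "Suc n * (2 * Suc n * (Suc (2 * n) choose Suc n)) =
      2 * Suc n * (Suc n * (Suc (2 * n) choose Suc n))" by (simp only: mult_ac)
  also have "\<dots> = 2 * Suc n * (Suc (2 * n) * ((2 * n) choose n))"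
    by (simp only: Suc_times_binomial)
  also have "\<dots> = Suc n * (2 * (2 * n + 1) * ((2 * n) choose n))"
    by (simp only: mult_ac Suc_eq_plus1)
  finally show ?thesis by (simp only: mult_cancel1) simp
qed

text \<open>For \<open>c\<close> = 12 and \<open>c\<close> = 20 this ratio is what the multipliers
  in \<open>ws20_rec\<close> and \<open>ws820_rec\<close> become when p is replaced by 0.\<close>

lemma alt_binom5_Suc:
  "alt_binom5 c (Suc n) =
    alt_binom5 c n * (- ((2 * (2 * of_nat n + 1) / (of_nat n + 1)) ^ 5 / 2 ^ c))"
proof -
  define A B :: rat where "A = of_nat ((2 * Suc n) choose Suc n)" and "B = of_nat ((2 * n) choose n)"
  have "of_nat (Suc n * ((2 * Suc n) choose Suc n)) =
      (of_nat (2 * (2 * n + 1) * ((2 * n) choose n)) :: rat)"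
    by (simp only: central_binomial_Suc)
  then have "(of_nat n + 1) * A = 2 * (2 * of_nat n + 1) * B"
    unfolding of_nat_mult A_def[symmetric] B_def[symmetric] by (simp add: add.commute)
  moreover have "(of_nat n + 1 :: rat) \<noteq> 0"
    using of_nat_neq_0[of n] by (simp add: add.commute)
  ultimately have "A = 2 * (2 * of_nat n + 1) / (of_nat n + 1) * B"
    by (simp add: field_simps)
  then show ?thesis
    unfolding alt_binom5_def A_def[symmetric] B_def[symmetric]
    by (simp add: power_mult_distrib power_divide power_add mult_ac)
qed

text \<open>The prime divides (2n)! but not n!.\<close>

lemma prime_dvd_central_binomial:
  fixes p n :: nat
  assumes "prime p" "p \<le> 2 * n" "n < p"
  shows "p dvd ((2 * n) choose n)"
proof -
  have "p dvd fact (2 * n)" using assms by (simp add: prime_dvd_fact_iff)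
  also have "fact (2 * n) = fact n * fact n * ((2 * n) choose n)"
    using binomial_fact_lemma[of n "2 * n"] by simp
  finally show ?thesis using assms by (simp add: prime_dvd_mult_iff prime_dvd_fact_iff)
qed

lemma odd_prime_not_dvd_power_2:
  fixes p :: nat
  assumes "prime p" "p > 2"
  shows "\<not> int p dvd 2 ^ k"
proof
  assume "int p dvd 2 ^ k"
  then have "int p dvd 2" using assms(1) prime_dvd_power[of "int p"] by simp
  then show False using assms(2) by (auto dest: zdvd_imp_le)
qed

lemma alt_binom5_cong_0:
  assumes "prime p" "p > 2" "p \<le> 2 * n" "n < p"
  shows "p_cong p 2 (alt_binom5 c n * of_int k) 0"
proof -
  obtain q where q: "(2 * n) choose n = p * q"
    using prime_dvd_central_binomial[OF assms(1,3,4)] by blast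
  have "\<not> int p dvd 2 ^ (c * n)"
    using assms by (intro odd_prime_not_dvd_power_2) auto
  then show ?thesis unfolding alt_binom5_def q
    \<comment> \<open>Two of the five factors \<open>p\<close> of the binomial power form the
      modulus; the other three stay in the witness.\<close>
    by (intro p_congI[OF p_integralI[of p "2 ^ (c * n)" _ "(-1) ^ n * int p ^ 3 * int q ^ 5 * k"]])
      (simp_all add: alt_binom5_def q power_mult_distrib, simp add: eval_nat_numeral)
qed

text \<open>Since \<open>W 0\<close> is 0, the unrolled recurrence settles the indices up to
  \<open>m\<close>; beyond \<open>m\<close> each term is already 0 modulo p^2.\<close>

lemma alt_binom5_sum_cong_0:
  assumes p: "prime p" "p = 2 * m + 1" "m > 0"
    and W: "\<And>n. n < m \<Longrightarrow> W n = U n + x n * W (Suc n)" "W 0 = 0"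
    and Wm: "p_cong p 2 (W m) (of_int (u m))"
    and U: "\<And>n. n < m \<Longrightarrow> p_cong p 2 (U n) (of_int (u n))"
    and x: "\<And>n. n < m \<Longrightarrow>
      p_cong p 2 (x n) (- ((2 * (2 * of_nat n + 1) / (of_nat n + 1)) ^ 5 / 2 ^ c))"
  shows "p_cong p 2 (\<Sum>n = 0..p - 1. alt_binom5 c n * of_int (u n)) 0"
proof -
  have n2: "\<not> int p dvd 2 ^ c"
    using p by (intro odd_prime_not_dvd_power_2) auto
  have y: "p_integral p (- ((2 * (2 * of_nat n + 1) / (of_nat n + 1)) ^ 5 / 2 ^ c))" if "n < m" for n
  proof (rule p_integralI)
    have "\<not> p dvd (n + 1)" using that p by (auto dest: dvd_imp_le)
    then have "\<not> int p dvd int (n + 1)" unfolding int_dvd_int_iff .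
    then show "\<not> int p dvd int (n + 1) ^ 5 * 2 ^ c"
      using n2 p(1) by (metis prime_dvd_mult_iff prime_dvd_power prime_nat_int_transfer)
    show "- ((2 * (2 * of_nat n + 1) / (of_nat n + 1)) ^ 5 / 2 ^ c) =
       of_int (- ((2 * (2 * int n + 1)) ^ 5)) / (of_int (int (n + 1) ^ 5 * 2 ^ c) :: rat)"
      by (simp add: power_divide add.commute)
  qed
  have 1: "p_cong p 2 (\<Sum>n\<le>m. alt_binom5 c n * of_int (u n)) 0"
    using backward_recurrence_sum_cong[OF p(1) W(1) Wm U x p_integral_of_int[OF p(1)] y, of "alt_binom5 c"]
    by (simp add: W(2) alt_binom5_Suc) (simp add: alt_binom5_def)
  have 2: "p_cong p 2 (\<Sum>n\<in>{m<..p - 1}. alt_binom5 c n * of_int (u n)) 0"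
    using p by (intro p_cong_sum_0 alt_binom5_cong_0) auto
  have "{0..p - 1} = {..m} \<union> {m<..p - 1}" using p by auto
  then have "(\<Sum>n = 0..p - 1. alt_binom5 c n * of_int (u n)) =
      (\<Sum>n\<le>m. alt_binom5 c n * of_int (u n)) + (\<Sum>n\<in>{m<..p - 1}. alt_binom5 c n * of_int (u n))"
    by (simp only:) (subst sum.union_disjoint, auto)
  then show ?thesis using p_cong_add[OF p(1) 1 2] by simp
qed

subsection \<open>Recurrences at the specialised parameters\<close>

text \<open>The recurrences are exact identities for odd \<open>p\<close>: oddness keeps the factors
  2k - p and 2k + p of their denominators away from 0. Primality enters only with the
  congruences.\<close>

locale odd_number =
  fixes p m :: nat
  assumes p_eq: "p = 2 * m + 1"
begin

lemma even_minus_p_nonzero: "2 * of_nat k - of_nat p \<noteq> (0 :: rat)"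
proof
  assume "2 * of_nat k - of_nat p = (0 :: rat)"
  then have "(of_nat (2 * k) :: rat) = of_nat p" by simp
  then have "2 * k = p" by (simp only: of_nat_eq_iff)
  then show False using p_eq by presburger
qed

lemma even_plus_p_nonzero: "2 * of_nat k + of_nat p \<noteq> (0 :: rat)"
  using p_eq of_nat_0_eq_iff[of "2 * k + p", where ?'a = rat] by simp

lemma m_eq: "(of_nat m :: rat) = (of_nat p - 1) / 2"
  by (simp add: p_eq)

lemma of_nat_plus_1_nonzero: "of_nat k + 1 \<noteq> (0 :: rat)"
  using of_nat_neq_0[of k, where ?'a = rat] by (simp add: add.commute)

text \<open>These are the parameters after \<open>n\<close> steps (a + 2; b + 1, c + 1, d + 1, e),
  with (1 + p)/2 = m + 1 and (1 - p)/2 = -m. For all \<open>n\<close> up to \<open>m\<close>,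
  \<open>Suc m\<close> terms suffice.\<close>

definition ws20 :: "nat \<Rightarrow> rat" where
  "ws20 n = well_poised_sum (Suc m) (1 / 2 + 2 * of_nat n) (of_nat m + 1 + of_nat n)
    (of_nat n - of_nat m) (1 / 2 + of_nat n) (1 / 2)"

definition ws820 :: "nat \<Rightarrow> rat" where
  "ws820 n = well_poised_sum (Suc m) (1 / 2 + 3 * of_nat n) (of_nat m + 1 + of_nat n)
    (of_nat n - of_nat m) (1 / 2 + of_nat n) (1 / 2 + of_nat n)"

lemma pochhammer_terminates: "n \<le> m \<Longrightarrow> pochhammer (of_nat n - of_nat m :: rat) (Suc m) = 0"
  using pochhammer_of_nat_eq_0_lemma[of "m - n" "Suc m", where ?'a = rat] by (simp add: of_nat_diff)

text \<open>The factor \<open>8 * N\<close> scales the inhomogeneous part to the required quadratic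
  polynomial up to P^2, and it vanishes at \<open>n = 0\<close>.\<close>

lemma ws20_rec:
  assumes "n \<le> m"
  defines "N \<equiv> of_nat n" and "P \<equiv> of_nat p"
  shows "8 * N * ws20 n = (20 * N ^ 2 + 8 * N + 1 - P ^ 2) +
    (- (((2 * N + 1) ^ 2 - P ^ 2) ^ 2 * (2 * N + 1) /
      (32 * ((2 * N + 2) ^ 2 - P ^ 2) * (N + 1) ^ 3))) * (8 * (N + 1) * ws20 (Suc n))"
proof -
  \<comment> \<open>\<open>e\<close> is -1/2 because \<open>well_poised_sum_raise_a\<close> has e +
    1 in both sums.\<close>
  define a b c d e :: rat where "a = 1 / 2 + 2 * N" and "b = of_nat m + 1 + N"
    and "c = N - of_nat m" and "d = 1 / 2 + N" and "e = - 1 / 2"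
  have c0: "pochhammer c (Suc m) = 0"
    using pochhammer_terminates[OF assms(1)] by (simp add: c_def N_def)
  have n1: "1 + a - b = (2 * N + 2 - P) / 2" by (simp add: a_def b_def m_eq P_def field_simps)
  have n2: "1 + a - c = (2 * N + 2 + P) / 2" by (simp add: a_def c_def m_eq P_def field_simps)
  have n3: "1 + a - d = N + 1" by (simp add: a_def d_def)
  have n4: "a - e = 2 * N + 1" by (simp add: a_def e_def)
  have z1: "2 * N + 2 - P + 2 * of_nat i \<noteq> 0" for i
    using even_minus_p_nonzero[of "n + 1 + i"] by (simp add: N_def P_def algebra_simps)
  have z2: "2 * N + 2 + P + 2 * of_nat i \<noteq> 0" for i
    using even_plus_p_nonzero[of "n + 1 + i"] by (simp add: N_def P_def algebra_simps)
  have z3: "N + 1 + of_nat i \<noteq> 0" for i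
    using of_nat_plus_1_nonzero[of "n + i"] by (simp add: N_def algebra_simps)
  have z4: "2 * N + 1 + of_nat i \<noteq> 0" for i
    using of_nat_plus_1_nonzero[of "2 * n + i"] by (simp add: N_def algebra_simps)
  have rec: "(a - e) * e * (b + c + d + e - 2 * a) * well_poised_sum (Suc m) a b c d (e + 1) =
    (a - b - e) * (a - c - e) * (a - d - e) *
      (a + b * c * d * e / ((1 + a - b) * (1 + a - c) * (1 + a - d) * (1 + a - e)) *
      well_poised_sum (Suc m) (a + 2) (b + 1) (c + 1) (d + 1) (e + 1))
      - (a - b) * (a - c) * (a - d) * (a - e)"
  proof (rule well_poised_sum_raise_a[OF c0])
    fix i :: nat
    show "1 + a - b + of_nat i \<noteq> 0" using z1[of i] unfolding n1 by (simp add: field_simps)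
    show "1 + a - c + of_nat i \<noteq> 0" using z2[of i] unfolding n2 by (simp add: field_simps)
    show "1 + a - d + of_nat i \<noteq> 0" using z3[of i] unfolding n3 .
    show "a - e + of_nat i \<noteq> 0" using z4[of i] unfolding n4 .
  qed
  have w: "well_poised_sum (Suc m) a b c d (e + 1) = ws20 n"
    by (simp add: ws20_def a_def b_def c_def d_def e_def N_def)
  have w': "well_poised_sum (Suc m) (a + 2) (b + 1) (c + 1) (d + 1) (e + 1) = ws20 (Suc n)"
    by (simp add: ws20_def a_def b_def c_def d_def e_def N_def algebra_simps)
  have f1: "a - b = (2 * N - P) / 2" "a - c = (2 * N + P) / 2" "a - d = N"
    "a - b - e = (2 * N + 1 - P) / 2" "a - c - e = (2 * N + 1 + P) / 2" "a - d - e = (2 * N + 1) / 2"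
    "1 + a - e = 2 * (N + 1)" "b + c + d + e - 2 * a = - N"
    "b = (2 * N + 1 + P) / 2" "c = (2 * N + 1 - P) / 2" "d = (2 * N + 1) / 2"
    by (simp_all add: a_def b_def c_def d_def e_def m_eq P_def field_simps)
  define D where "D = (2 * N + 2) ^ 2 - P ^ 2"
  have D: "D = (2 * N + 2 - P) * (2 * N + 2 + P)" unfolding D_def by algebra
  define Q where "Q = (2 * N + 1) ^ 2 - P ^ 2"
  have Q: "Q = (2 * N + 1 - P) * (2 * N + 1 + P)" unfolding Q_def by algebra
  define M K where "M = 2 * N + 1" and "K = N + 1"
  have K0: "K \<noteq> 0" using z3[of 0] by (simp add: K_def)
  define F where "F = Q * M / (8 * D * K ^ 2) * ws20 (Suc n)"
  have X: "b * c * d * e / ((1 + a - b) * (1 + a - c) * (1 + a - d) * (1 + a - e)) * ws20 (Suc n) = - F"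
    unfolding n1 n2 n3 f1(7)
    unfolding f1(9-11) e_def D Q F_def M_def[symmetric] K_def[symmetric]
    by (simp add: power2_eq_square) (simp only: mult_ac)
  have P3: "(a - b - e) * (a - c - e) * (a - d - e) = Q * M / 8"
    unfolding f1(4-6) Q M_def by simp
  have r: "M * (- 1 / 2) * (- N) * ws20 n =
      Q * M / 8 * (a + - F) - (2 * N - P) / 2 * ((2 * N + P) / 2) * N * M"
    using rec unfolding w w' X P3 n4 f1(8) unfolding f1(1-3) e_def M_def .
  \<comment> \<open>Every term of \<open>r\<close> carries the factor \<open>M\<close>, which is
    nonzero and is cancelled; 16 clears the numerical denominators.\<close>
  have "M * (8 * N * ws20 n) = 16 * (M * (- 1 / 2) * (- N) * ws20 n)" by simp
  also have "\<dots> = M * (2 * Q * (a - F) - 4 * (2 * N - P) * (2 * N + P) * N)"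
    unfolding r by (simp add: field_simps)
  finally have "8 * N * ws20 n = 2 * Q * (a - F) - 4 * (2 * N - P) * (2 * N + P) * N"
    using z4[of 0] by (simp add: M_def)
  moreover have "2 * Q * a - 4 * (2 * N - P) * (2 * N + P) * N = 20 * N ^ 2 + 8 * N + 1 - P ^ 2"
    unfolding Q_def a_def by (simp add: power2_eq_square algebra_simps)
  moreover have "- (Q ^ 2 * M / (32 * D * K ^ 3)) * (8 * K * ws20 (Suc n)) = - 2 * Q * F"
    using K0 by (simp add: F_def power2_eq_square power3_eq_cube mult_ac)
  ultimately show ?thesis
    unfolding Q_def[symmetric] D_def[symmetric]
    unfolding M_def[symmetric] K_def[symmetric]
    by (simp add: right_diff_distrib)
qed

text \<open>Two relations are chained through the intermediate sum \<open>wB\<close> at (a + 1; b,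
  c, d, e + 1). At P = 0 the inhomogeneous part is 128 (N + 6 N^2) + 13 A = 820 N^2 + 180 N +
  13.\<close>

lemma ws820_rec:
  assumes "n \<le> m"
  defines "N \<equiv> of_nat n" and "P \<equiv> of_nat p"
  defines "A \<equiv> (2 * N + 1) ^ 2" and "B \<equiv> (2 * N + 2) ^ 2"
  shows "256 * N * ws820 n = (128 * (N + 6 * N ^ 2) + 16 * (A - P ^ 2)
      - 12 * (A - P ^ 2) ^ 2 / (4 * A - P ^ 2)) +
    (- (A * (A - P ^ 2) ^ 3 / (64 * (4 * A - P ^ 2) * (4 * B - P ^ 2) * B * (2 * N + 1) * (2 * N + 2))))
      * (256 * (N + 1) * ws820 (Suc n))"
proof -
  define a b c d e :: rat where "a = 1 / 2 + 3 * N" and "b = of_nat m + 1 + N"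
    and "c = N - of_nat m" and "d = 1 / 2 + N" and "e = 1 / 2 + N"
  \<comment> \<open>Here \<open>K\<close> is 2N + 2, not N + 1 as in \<open>ws20_rec\<close>:
    raising a by 1 turns \<open>M\<close> into \<open>K\<close> in the denominators.\<close>
  define M K where "M = 2 * N + 1" and "K = M + 1"
  have c0: "pochhammer c (Suc m) = 0"
    using pochhammer_terminates[OF assms(1)] by (simp add: c_def N_def)
  have n1: "1 + a - b = (2 * M - P) / 2" "1 + a - c = (2 * M + P) / 2"
      "1 + a - d = M" "1 + a - e = M"
      "1 + (a + 1) - b = (2 * K - P) / 2" "1 + (a + 1) - c = (2 * K + P) / 2"
      "1 + (a + 1) - d = K" "1 + (a + 1) - e = K" "a + 1 - e = M"
    by (simp_all add: a_def b_def c_def d_def e_def m_eq P_def M_def K_def field_simps)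
  have z1: "2 * M - P + 2 * of_nat i \<noteq> 0" for i
    using even_minus_p_nonzero[of "2 * n + 1 + i"] by (simp add: N_def P_def M_def algebra_simps)
  have z2: "2 * M + P + 2 * of_nat i \<noteq> 0" for i
    using even_plus_p_nonzero[of "2 * n + 1 + i"] by (simp add: N_def P_def M_def algebra_simps)
  have z3: "M + of_nat i \<noteq> 0" for i
    using of_nat_plus_1_nonzero[of "2 * n + i"] by (simp add: N_def M_def algebra_simps)
  have z4: "2 * K - P + 2 * of_nat i \<noteq> 0" "2 * K + P + 2 * of_nat i \<noteq> 0"
    "K + of_nat i \<noteq> 0" for i
    using z1[of "Suc i"] z2[of "Suc i"] z3[of "Suc i"] by (simp_all add: K_def algebra_simps)
  define wB where "wB = well_poised_sum (Suc m) (a + 1) b c d (e + 1)"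
  have rec1: "(1 + 2 * a - b - c - d - e) * well_poised_sum (Suc m) a b c d e =
    (a - e) * (1 + 2 * a - b - c - d) +
    e * (1 + a - b - c) * (1 + a - b - d) * (1 + a - c - d) /
      ((1 + a - b) * (1 + a - c) * (1 + a - d)) * wB"
    unfolding wB_def
  proof (rule well_poised_sum_raise_a_e[OF c0])
    fix i :: nat
    show "1 + a - b + of_nat i \<noteq> 0" using z1[of i] unfolding n1 by (simp add: field_simps)
    show "1 + a - c + of_nat i \<noteq> 0" using z2[of i] unfolding n1 by (simp add: field_simps)
    show "1 + a - d + of_nat i \<noteq> 0" using z3[of i] unfolding n1 .
    show "1 + a - e + of_nat i \<noteq> 0" using z3[of i] unfolding n1 .
  qed
  have rec2: "(a + 1 - e) * e * (b + c + d + e - 2 * (a + 1)) * wB =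
    (a + 1 - b - e) * (a + 1 - c - e) * (a + 1 - d - e) *
      (a + 1 + b * c * d * e / ((1 + (a + 1) - b) * (1 + (a + 1) - c) * (1 + (a + 1) - d) * (1 + (a + 1) - e)) *
      well_poised_sum (Suc m) (a + 1 + 2) (b + 1) (c + 1) (d + 1) (e + 1))
      - (a + 1 - b) * (a + 1 - c) * (a + 1 - d) * (a + 1 - e)"
    unfolding wB_def
  proof (rule well_poised_sum_raise_a[OF c0])
    fix i :: nat
    show "1 + (a + 1) - b + of_nat i \<noteq> 0" using z4(1)[of i] unfolding n1 by (simp add: field_simps)
    show "1 + (a + 1) - c + of_nat i \<noteq> 0" using z4(2)[of i] unfolding n1 by (simp add: field_simps)
    show "1 + (a + 1) - d + of_nat i \<noteq> 0" using z4(3)[of i] unfolding n1 .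
    show "a + 1 - e + of_nat i \<noteq> 0" using z3[of i] unfolding n1 .
  qed
  have w: "well_poised_sum (Suc m) a b c d e = ws820 n"
    by (simp add: ws820_def a_def b_def c_def d_def e_def N_def)
  have w': "well_poised_sum (Suc m) (a + 1 + 2) (b + 1) (c + 1) (d + 1) (e + 1) = ws820 (Suc n)"
    by (simp add: ws820_def a_def b_def c_def d_def e_def N_def algebra_simps)
  define Q E1 E2 where "Q = A - P ^ 2" and "E1 = 4 * A - P ^ 2" and "E2 = 4 * B - P ^ 2"
  have Q: "Q = (M - P) * (M + P)" unfolding Q_def A_def M_def by algebra
  have E1: "E1 = (2 * M - P) * (2 * M + P)" unfolding E1_def A_def M_def by algebra
  have E2: "E2 = (2 * K - P) * (2 * K + P)" unfolding E2_def B_def M_def K_def by algebra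
  have A: "A = M ^ 2" and B: "B = K ^ 2" by (simp_all add: A_def B_def M_def K_def add.commute)
  have M0: "M \<noteq> 0" "K \<noteq> 0" using z3[of 0] z4(3)[of 0] by simp_all
  have E0: "E1 \<noteq> 0" using z1[of 0] z2[of 0] by (simp add: E1)
  define F where "F = Q * A / (4 * E2 * B) * ws820 (Suc n)"
  have f: "b = (M + P) / 2" "c = (M - P) / 2" "d = M / 2" "e = M / 2"
    by (simp_all add: b_def c_def d_def e_def m_eq P_def M_def field_simps)
  have g: "1 + a - b - c = M / 2" "1 + a - b - d = (M - P) / 2" "1 + a - c - d = (M + P) / 2"
    "a + 1 - b - e = (M - P) / 2" "a + 1 - c - e = (M + P) / 2" "a + 1 - d - e = M / 2"
    "a + 1 - b = (2 * M - P) / 2" "a + 1 - c = (2 * M + P) / 2" "a + 1 - d = M"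
    "b + c + d + e - 2 * (a + 1) = - M" "1 + 2 * a - b - c - d - e = 2 * N"
    "a - e = 2 * N" "1 + 2 * a - b - c - d = a"
    by (simp_all add: a_def b_def c_def d_def e_def m_eq P_def M_def field_simps)
  have a1: "a + 1 = 3 / 2 * M" by (simp add: a_def M_def)
  have X: "b * c * d * e / ((1 + (a + 1) - b) * (1 + (a + 1) - c) * (1 + (a + 1) - d) * (1 + (a + 1) - e))
      * ws820 (Suc n) = F"
    unfolding n1 unfolding f F_def Q E2 A B
    by (simp add: power2_eq_square) (simp only: mult_ac)
  have r2: "M * e * - M * wB = (M - P) / 2 * ((M + P) / 2) * (M / 2) * (a + 1 + F)
      - (2 * M - P) / 2 * ((2 * M + P) / 2) * M * M"
    using rec2 unfolding w' X n1(9) unfolding g(4-6) unfolding g .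
  \<comment> \<open>Both relations contain \<open>wB\<close> only through \<open>e * wB\<close>, so
    this product is eliminated.\<close>
  have "M * M * (e * wB) = - (M * e * - M * wB)" by simp
  also have "\<dots> = M * M * (E1 / 4) - M * Q / 8 * (a + 1 + F)"
    unfolding r2 Q E1 by (simp add: field_simps)
  also have "\<dots> = M * M * (E1 / 4 - Q * (a + 1 + F) / (8 * M))"
    using M0(1) by (simp add: right_diff_distrib)
  finally have eq: "e * wB = E1 / 4 - Q * (a + 1 + F) / (8 * M)" using M0(1) by simp
  have r1: "2 * N * ws820 n = 2 * N * a +
      e * (M / 2) * ((M - P) / 2) * ((M + P) / 2) / ((2 * M - P) / 2 * ((2 * M + P) / 2) * M) * wB"
    using rec1 unfolding w g(1-3) unfolding n1(1-3) unfolding g .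
  have r3: "M / 2 * ((M - P) / 2) * ((M + P) / 2) / ((2 * M - P) / 2 * ((2 * M + P) / 2) * M) =
      Q / (2 * E1)"
    using M0(1) by (simp add: Q E1)
  have "2 * N * ws820 n = 2 * N * a + Q / (2 * E1) * (e * wB)"
    unfolding r1 r3[symmetric] by simp
  also have "Q / (2 * E1) * (e * wB) = Q / 8 - 3 * Q ^ 2 / (32 * E1) - Q ^ 2 * F / (16 * M * E1)"
    unfolding eq a1 using M0(1) E0 by (simp add: field_simps power2_eq_square)
  finally have r4: "2 * N * ws820 n =
      2 * N * a + (Q / 8 - 3 * Q ^ 2 / (32 * E1) - Q ^ 2 * F / (16 * M * E1))" .
  have "256 * N * ws820 n = 128 * (2 * N * ws820 n)" by simp
  also have "\<dots> = 256 * N * a + 16 * Q - 12 * Q ^ 2 / E1 - 8 * Q ^ 2 * F / (M * E1)"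
    unfolding r4 by (simp add: algebra_simps)
  finally have "256 * N * ws820 n =
      256 * N * a + 16 * Q - 12 * Q ^ 2 / E1 - 8 * Q ^ 2 * F / (M * E1)" .
  moreover have "256 * N * a = 128 * (N + 6 * N ^ 2)"
    by (simp add: a_def algebra_simps power2_eq_square)
  moreover have "- (A * Q ^ 3 / (64 * E1 * E2 * B * M * (2 * N + 2))) * (256 * (N + 1) * ws820 (Suc n)) =
      - (8 * Q ^ 2 * F / (M * E1))"
  proof -
    have KN: "2 * N + 2 = K" "256 * (N + 1) = 128 * K" by (simp_all add: M_def K_def)
    show ?thesis using M0 unfolding KN F_def B
      by (simp add: power2_eq_square power3_eq_cube mult_ac)
  qed
  ultimately show ?thesis
    unfolding Q_def[symmetric] E1_def[symmetric] E2_def[symmetric] M_def[symmetric] by simp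
qed

lemma ws20_last: "ws20 m = 1 / 2 + 2 * of_nat m"
  by (simp add: ws20_def well_poised_sum_zero_parameter)

lemma ws820_last: "ws820 m = 1 / 2 + 3 * of_nat m"
  by (simp add: ws820_def well_poised_sum_zero_parameter)

end

section \<open>The two sums modulo p^2\<close>

locale odd_prime = odd_number +
  assumes prime: "prime p" and m_pos: "m > 0"
begin

lemma prime_int: "prime (int p)"
  using prime by simp

lemma not_dvd_2: "\<not> int p dvd 2"
  using odd_prime_not_dvd_power_2[of p 1] prime p_eq m_pos by simp

lemma not_dvd_small: "0 < k \<Longrightarrow> k < p \<Longrightarrow> \<not> int p dvd int k"
  by (auto dest: dvd_imp_le)

lemma not_dvd_minus_square: "\<not> int p dvd x \<Longrightarrow> \<not> int p dvd x - int p ^ 2"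
  by (simp add: dvd_diff_left_iff power2_eq_square)

lemma not_dvd_mult: "\<not> int p dvd x \<Longrightarrow> \<not> int p dvd y \<Longrightarrow> \<not> int p dvd x * y"
  using prime_int by (simp add: prime_dvd_mult_iff)

lemma not_dvd_power: "\<not> int p dvd x \<Longrightarrow> \<not> int p dvd x ^ k"
  using prime_int prime_dvd_power by blast

lemmas not_dvd_intros = not_dvd_minus_square not_dvd_mult not_dvd_power

lemma sum_20_cong:
  "p_cong p 2 (\<Sum>n = 0..p - 1. alt_binom5 12 n * of_int (20 * int n ^ 2 + 8 * int n + 1)) 0"
proof (rule alt_binom5_sum_cong_0[OF prime p_eq m_pos])
  show "8 * of_nat n * ws20 n = (20 * of_nat n ^ 2 + 8 * of_nat n + 1 - of_nat p ^ 2) +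
    (- (((2 * of_nat n + 1) ^ 2 - of_nat p ^ 2) ^ 2 * (2 * of_nat n + 1) /
      (32 * ((2 * of_nat n + 2) ^ 2 - of_nat p ^ 2) * (of_nat n + 1) ^ 3))) * (8 * of_nat (Suc n) * ws20 (Suc n))"
    if "n < m" for n
    using ws20_rec[of n] that by (simp add: add.commute)
  show "8 * of_nat 0 * ws20 0 = 0" by simp
  \<comment> \<open>The difference is 8m (1/2 + 2m) - (20 m^2 + 8m + 1) = -(2m + 1)^2 =
    -p^2.\<close>
  show "p_cong p 2 (8 * of_nat m * ws20 m) (of_int (20 * int m ^ 2 + 8 * int m + 1))"
    by (rule p_congI[OF p_integral_of_int[OF prime, of "- 1"]])
      (simp add: ws20_last p_eq algebra_simps power2_eq_square)
  fix n assume n: "n < m"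
  show "p_cong p 2 (20 * of_nat n ^ 2 + 8 * of_nat n + 1 - of_nat p ^ 2)
      (of_int (20 * int n ^ 2 + 8 * int n + 1))"
    by (rule p_congI[OF p_integral_of_int[OF prime, of "- 1"]]) simp
  define K M where "K = int n + 1" and "M = 2 * int n + 1"
  define q A B where "q = int p ^ 2" and "A = M ^ 2" and "B = (2 * K) ^ 2"
  \<comment> \<open>\<open>D\<close> is a common denominator of both multipliers: as
    \<open>B\<close> is 4 K^2, it equals \<open>B\<close> times 32 (B - q) K^3.\<close>
  define D where "D = 128 * K ^ 5 * (B - q)"
  have K: "\<not> int p dvd K" using not_dvd_small[of "n + 1"] n p_eq by (simp add: K_def add.commute)
  have E: "\<not> int p dvd B - q"
    unfolding B_def q_def by (intro not_dvd_intros K not_dvd_2)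
  have D: "\<not> int p dvd D"
    using not_dvd_power[OF not_dvd_2, of 7] unfolding D_def
    by (intro not_dvd_mult E not_dvd_power[OF K]) simp
  have K0: "of_int K \<noteq> (0 :: rat)" and E0: "of_int (B - q) \<noteq> (0 :: rat)"
    using K E by (auto simp only: of_int_eq_0_iff)
  have 1: "(- (((2 * of_nat n + 1) ^ 2 - of_nat p ^ 2) ^ 2 * (2 * of_nat n + 1) /
      (32 * ((2 * of_nat n + 2) ^ 2 - of_nat p ^ 2) * (of_nat n + 1) ^ 3)) :: rat) =
      of_int (- ((A - q) ^ 2 * M)) / of_int (32 * (B - q) * K ^ 3)"
    by (simp add: A_def B_def K_def M_def q_def)
  also have "\<dots> = of_int (- ((A - q) ^ 2 * M * B)) / of_int D"
    using K0 E0 by (simp add: D_def divide_simps) (simp add: B_def eval_nat_numeral)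
  finally have x: "(- (((2 * of_nat n + 1) ^ 2 - of_nat p ^ 2) ^ 2 * (2 * of_nat n + 1) /
      (32 * ((2 * of_nat n + 2) ^ 2 - of_nat p ^ 2) * (of_nat n + 1) ^ 3)) :: rat) =
      of_int (- ((A - q) ^ 2 * M * B)) / of_int D" .
  have KM: "2 * of_nat n + 1 = (of_int M :: rat)" "of_nat n + 1 = (of_int K :: rat)"
    by (simp_all add: K_def M_def)
  have "(- ((2 * (2 * of_nat n + 1) / (of_nat n + 1)) ^ 5 / 2 ^ 12) :: rat) =
      of_int (- (M * A ^ 2)) / of_int (128 * K ^ 5)"
    unfolding KM by (simp add: A_def power_divide power_mult_distrib) (simp add: eval_nat_numeral)
  also have "\<dots> = of_int (- (M * A ^ 2 * (B - q))) / of_int D"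
    using K0 E0 by (simp add: D_def divide_simps)
  finally have y: "(- ((2 * (2 * of_nat n + 1) / (of_nat n + 1)) ^ 5 / 2 ^ 12) :: rat) =
      of_int (- (M * A ^ 2 * (B - q))) / of_int D" .
  \<comment> \<open>The two numerators over \<open>D\<close> coincide at q = 0, hence differ by a
    multiple of q = p^2.\<close>
  have "- ((A - q) ^ 2 * M * B) = - (M * A ^ 2 * (B - q)) + q * (- (M * (A ^ 2 - 2 * A * B + q * B)))"
    by algebra
  then have "of_int (- ((A - q) ^ 2 * M * B)) / of_int D = (of_int (- (M * A ^ 2 * (B - q))) / of_int D :: rat)
      + of_nat p ^ 2 * (of_int (- (M * (A ^ 2 - 2 * A * B + q * B))) / of_int D)"
    by (simp only: of_int_add of_int_mult add_divide_distrib) (simp add: q_def)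
  then show "p_cong p 2 (- (((2 * of_nat n + 1) ^ 2 - of_nat p ^ 2) ^ 2 * (2 * of_nat n + 1) /
      (32 * ((2 * of_nat n + 2) ^ 2 - of_nat p ^ 2) * (of_nat n + 1) ^ 3)))
     (- ((2 * (2 * of_nat n + 1) / (of_nat n + 1)) ^ 5 / 2 ^ 12))"
    unfolding x y by (rule p_congI[OF p_integralI[OF D refl]])
qed


lemma sum_820_cong:
  "p_cong p 2 (\<Sum>n = 0..p - 1. alt_binom5 20 n * of_int (820 * int n ^ 2 + 180 * int n + 13)) 0"
proof (rule alt_binom5_sum_cong_0[OF prime p_eq m_pos])
  define A B :: "nat \<Rightarrow> rat" where "A n = (2 * of_nat n + 1) ^ 2" and "B n = (2 * of_nat n + 2) ^ 2" for n
  define U where "U n = 128 * (of_nat n + 6 * of_nat n ^ 2) + 16 * (A n - of_nat p ^ 2)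
      - 12 * (A n - of_nat p ^ 2) ^ 2 / (4 * A n - of_nat p ^ 2)" for n
  define x where "x n = - (A n * (A n - of_nat p ^ 2) ^ 3 / (64 * (4 * A n - of_nat p ^ 2) *
      (4 * B n - of_nat p ^ 2) * B n * (2 * of_nat n + 1) * (2 * of_nat n + 2)))" for n
  show "256 * of_nat n * ws820 n = U n + x n * (256 * of_nat (Suc n) * ws820 (Suc n))" if "n < m" for n
    using ws820_rec[of n] that by (simp add: add.commute U_def x_def A_def B_def)
  show "256 * of_nat 0 * ws820 0 = 0" by simp
  \<comment> \<open>The difference is 256m (1/2 + 3m) - (820 m^2 + 180m + 13) = -13 (2m + 1)^2 = -13
    p^2.\<close>
  show "p_cong p 2 (256 * of_nat m * ws820 m) (of_int (820 * int m ^ 2 + 180 * int m + 13))"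
    by (rule p_congI[OF p_integral_of_int[OF prime, of "- 13"]])
      (simp add: ws820_last p_eq algebra_simps power2_eq_square)
  fix n assume n: "n < m"
  define K M where "K = int n + 1" and "M = 2 * int n + 1"
  define q a b where "q = int p ^ 2" and "a = M ^ 2" and "b = (2 * K) ^ 2"
  define D where "D = 1024 * (b ^ 2 * M * (2 * K) * (4 * a - q) * (4 * b - q))"
  have K: "\<not> int p dvd K" using not_dvd_small[of "n + 1"] n p_eq by (simp add: K_def add.commute)
  have M: "\<not> int p dvd M" using not_dvd_small[of "2 * n + 1"] n p_eq by (simp add: M_def add.commute)
  have 4: "\<not> int p dvd 4" using not_dvd_power[OF not_dvd_2, of 2] by simp
  have E1: "\<not> int p dvd 4 * a - q"
    unfolding a_def q_def by (intro not_dvd_intros M 4)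
  have E2: "\<not> int p dvd 4 * b - q"
    unfolding b_def q_def by (intro not_dvd_intros K 4 not_dvd_2)
  have D: "\<not> int p dvd D"
    using not_dvd_power[OF not_dvd_2, of 10] unfolding D_def b_def
    by (intro not_dvd_mult E1 E2[unfolded b_def] not_dvd_power K M not_dvd_2) simp_all
  have nz: "of_int K \<noteq> (0 :: rat)" "of_int M \<noteq> (0 :: rat)"
    "of_int (4 * a - q) \<noteq> (0 :: rat)" "of_int (4 * b - q) \<noteq> (0 :: rat)"
    using K M E1 E2 by (auto simp only: of_int_eq_0_iff)
  then have b0: "of_int b \<noteq> (0 :: rat)" by (simp add: b_def)
  have ab: "A n = of_int a" "B n = of_int b" "of_nat p ^ 2 = (of_int q :: rat)"
      "2 * of_nat n + 1 = (of_int M :: rat)" "2 * of_nat n + 2 = (2 * of_int K :: rat)"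
      "of_nat n + 1 = (of_int K :: rat)"
    by (simp_all add: A_def B_def a_def b_def q_def M_def K_def)
  show "p_cong p 2 (U n) (of_int (820 * int n ^ 2 + 180 * int n + 13))"
  proof (rule p_congI[OF p_integralI[OF E1 refl]])
    have "128 * (of_nat n + 6 * of_nat n ^ 2) + 13 * of_int a =
        (of_int (820 * int n ^ 2 + 180 * int n + 13) :: rat)"
      by (simp add: a_def M_def power2_eq_square algebra_simps)
    \<comment> \<open>At q = 0 the left side is 16a - 3a = 13a; the remaining numerator is divisible
      by q, with quotient 4q - 43a.\<close>
    moreover have "16 * (A n - of_nat p ^ 2) - 12 * (A n - of_nat p ^ 2) ^ 2 / (4 * A n - of_nat p ^ 2) =
        13 * of_int a + of_nat p ^ 2 * (of_int (4 * q - 43 * a) / of_int (4 * a - q))"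
      using nz(3) unfolding ab by (simp add: field_simps power2_eq_square)
    ultimately show "U n = of_int (820 * int n ^ 2 + 180 * int n + 13) +
        of_nat p ^ 2 * (of_int (4 * q - 43 * a) / of_int (4 * a - q))"
      unfolding U_def by linarith
  qed
  have x: "x n = of_int (- (16 * a * b * (a - q) ^ 3)) / of_int D"
    using nz b0 unfolding x_def ab by (simp add: D_def divide_simps) (simp add: eval_nat_numeral)
  have "(- ((2 * (2 * of_nat n + 1) / (of_nat n + 1)) ^ 5 / 2 ^ 20) :: rat) =
      of_int (- (a ^ 3)) / of_int (1024 * (b ^ 2 * M * (2 * K)))"
    using nz unfolding ab by (simp add: a_def b_def power_divide power_mult_distrib) (simp add: eval_nat_numeral)
  also have "\<dots> = of_int (- (a ^ 3 * (4 * a - q) * (4 * b - q))) / of_int D"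
    using nz b0 by (simp add: D_def divide_simps)
  finally have y: "(- ((2 * (2 * of_nat n + 1) / (of_nat n + 1)) ^ 5 / 2 ^ 20) :: rat) =
      of_int (- (a ^ 3 * (4 * a - q) * (4 * b - q))) / of_int D" .
  \<comment> \<open>\<open>Z\<close> is the quotient by q of the difference of the two numerators
    over \<open>D\<close>, which agree at q = 0.\<close>
  define Z where "Z = - (a * (16 * b * (3 * a * q - 3 * a ^ 2 - q ^ 2) + 4 * a ^ 3 + 4 * a ^ 2 * b - a ^ 2 * q))"
  have "- (16 * a * b * (a - q) ^ 3) = - (a ^ 3 * (4 * a - q) * (4 * b - q)) + q * Z"
    unfolding Z_def by algebra
  then have "of_int (- (16 * a * b * (a - q) ^ 3)) / of_int D =
      (of_int (- (a ^ 3 * (4 * a - q) * (4 * b - q))) / of_int D :: rat) +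
      of_nat p ^ 2 * (of_int Z / of_int D)"
    by (simp only: of_int_add of_int_mult add_divide_distrib) (simp add: q_def)
  then show "p_cong p 2 (x n) (- ((2 * (2 * of_nat n + 1) / (of_nat n + 1)) ^ 5 / 2 ^ 20))"
    unfolding x y by (rule p_congI[OF p_integralI[OF D refl]])
qed

end

text \<open>Used to pass from the modulus p^2 of \<open>sum_820_cong\<close> to the weaker modulus p
  of the second claim.\<close>

lemma p_cong_le:
  assumes "prime p" "s \<le> r" "p_cong p r x y"
  shows "p_cong p s x y"
proof -
  obtain z where "p_integral p z" "x = y + of_nat p ^ r * z"
    using assms(3) unfolding p_cong_def by blast
  then show ?thesis
    using p_integral_mult[OF assms(1) p_integral_of_int[OF assms(1), of "int p ^ (r - s)"]] assms(2)
    by (intro p_congI[of p "of_nat p ^ (r - s) * z"]) (simp_all add: power_add[symmetric] flip: mult.assoc)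
qed

theorem theorem7:
  fixes p :: nat
  assumes "prime p" and "p > 2"
  shows "rat_cong p 2
           (\<Sum>n = 0..p - 1. (-1) ^ n * (20 * of_nat n ^ 2 + 8 * of_nat n + 1) / 2 ^ (12 * n)
              * of_nat ((2 * n) choose n) ^ 5) 0
       \<and> rat_cong p 1
           (\<Sum>n = 0..p - 1. (-1) ^ n * (820 * of_nat n ^ 2 + 180 * of_nat n + 13) / 2 ^ (20 * n)
              * of_nat ((2 * n) choose n) ^ 5) 0"
proof -
  have "odd p" using assms by (simp add: prime_odd_nat)
  then obtain m where m: "p = 2 * m + 1" by (rule oddE)
  interpret odd_prime p m
    by unfold_locales (use m assms in auto)
  show ?thesis
    using p_cong_imp_rat_cong[OF prime sum_20_cong]
      p_cong_imp_rat_cong[OF prime p_cong_le[OF prime _ sum_820_cong, of 1]]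
    by (simp add: alt_binom5_def mult_ac)
qed

end
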